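(* Let $P$ be a simple $d$-polytope and let $2\le k\le d-1$. For every $k$-system $\mathcal{S}$ of $\mathcal{G}_P$ and every acyclic orientation $\mathcal{O}$ of $\mathcal{G}_P$, the inequalities $$|\mathcal{S}|\ \le\ f_k(P)\ \le\ \mathcal{H}_k(\mathcal{O})$$ hold. Moreover, the first inequality $|\mathcal{S}|\le f_k(P)$ holds with equality if and only if $\mathcal{S}=\mathcal{V}_k(P)$, and the second inequality $f_k(P)\le \mathcal{H}_k(\mathcal{O})$ holds with equality if and only if $\mathcal{O}$ induces precisely one sink on every $k$-face of $P$.
   Context: A $d$-polytope $P$ is simple if every vertex of $P$ is contained in exactly $d$ edges. $\mathcal{G}_P=(\mathcal{V}(P),\mathcal{E}(P))$ denotes the abstract vertex-edge graph of $P$. For $W\subseteq\mathcal{V}(P)$, $\mathcal{G}_P(W)$ is the subgraph of $\mathcal{G}_P$ induced by $W$. $\mathcal{V}_k(P)$ is the set of vertex sets of the $k$-faces ($k$-dimensional faces) of $P$, and $f_k(P)=|\mathcal{V}_k(P)|$ is the number of $k$-faces. A face $F$ is identified with the subgraph of $\mathcal{G}_P$ induced by the vertices of $F$. For $2\le k\le d-1$, a $k$-frame of $P$ is a (not necessarily induced) subgraph of $\mathcal{G}_P$ isomorphic to the star $K_{1,k}$; its vertex of degree $k$ is the root. A set $\mathcal{S}$ of non-empty subsets of $\mathcal{V}(P)$ is a $k$-system of $\mathcal{G}_P$ if for every $S\in\mathcal{S}$ the induced subgraph $\mathcal{G}_P(S)$ is $k$-regular, and the node set of every $k$-frame of $P$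 is contained in a unique set from $\mathcal{S}$. For an acyclic orientation $\mathcal{O}$ of $\mathcal{G}_P$ (no directed cycles) and $0\le i\le d$, $h_i(\mathcal{O})$ is the number of vertices of $\mathcal{G}_P$ with precisely $i$ of their incident edges directed inwards, and $\mathcal{H}_k(\mathcal{O})=\sum_{i=0}^d h_i(\mathcal{O})\binom{i}{k}$. A sink induced by $\mathcal{O}$ on a face $F$ is a vertex of $F$ all of whose incident edges in the induced subgraph of $\mathcal{G}_P$ on the vertices of $F$ are directed towards it. *)

theory Defs
  imports "HOL-Analysis.Analysis"
begin

text \<open>The record type does not constrain the edges; \<open>simple_graph\<close> below states that they are
  two-element sets of nodes.\<close>

record 'v ugraph =
  nodes :: "'v set"
  edges :: "'v set set"

definition simple_graph :: "'v ugraph \<Rightarrow> bool" where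
  "simple_graph G \<longleftrightarrow> finite (nodes G) \<and> (\<forall>e\<in>edges G. e \<subseteq> nodes G \<and> card e = 2)"

definition is_subgraph :: "'v ugraph \<Rightarrow> 'v ugraph \<Rightarrow> bool" where
  "is_subgraph H G \<longleftrightarrow> simple_graph H \<and> nodes H \<subseteq> nodes G \<and> edges H \<subseteq> edges G"

definition induced :: "'v ugraph \<Rightarrow> 'v set \<Rightarrow> 'v ugraph" where
  "induced G W = \<lparr>nodes = W, edges = {e \<in> edges G. e \<subseteq> W}\<rparr>"

definition graph_isomorphic :: "'v ugraph \<Rightarrow> 'w ugraph \<Rightarrow> bool" where
  "graph_isomorphic G H \<longleftrightarrow>
     (\<exists>f. bij_betw f (nodes G) (nodes H) \<and>
          (\<forall>u\<in>nodes G. \<forall>v\<in>nodes G. {u, v} \<in> edges G \<longleftrightarrow> {f u, f v} \<in> edges H))"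

definition regular :: "nat \<Rightarrow> 'v ugraph \<Rightarrow> bool" where
  "regular k G \<longleftrightarrow> (\<forall>v\<in>nodes G. card {e \<in> edges G. v \<in> e} = k)"

text \<open>The star \<open>K\<^bsub>1,k\<^esub>\<close>, with root \<open>0\<close>.\<close>

definition star :: "nat \<Rightarrow> nat ugraph" where
  "star k = \<lparr>nodes = {0..k}, edges = {{0, i} | i. i \<in> {1..k}}\<rparr>"

text \<open>An orientation is a set of arcs; \<open>(u, v)\<close> is the edge \<open>{u, v}\<close> directed from \<open>u\<close> to \<open>v\<close>.\<close>

definition orientation :: "'v ugraph \<Rightarrow> ('v \<times> 'v) set \<Rightarrow> bool" where
  "orientation G A \<longleftrightarrow>
     (\<forall>(u, v)\<in>A. {u, v} \<in> edges G) \<and>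
     (\<forall>u v. {u, v} \<in> edges G \<longrightarrow> ((u, v) \<in> A \<longleftrightarrow> (v, u) \<notin> A))"

definition acyclic_orientation :: "'v ugraph \<Rightarrow> ('v \<times> 'v) set \<Rightarrow> bool" where
  "acyclic_orientation G A \<longleftrightarrow> orientation G A \<and> acyclic A"

text \<open>\<open>{u. (u, v) \<in> A}\<close> corresponds to the edges at \<open>v\<close> directed inwards, since an
  orientation contains only arcs along edges of the graph.\<close>

definition h_num :: "'v ugraph \<Rightarrow> ('v \<times> 'v) set \<Rightarrow> nat \<Rightarrow> nat" where
  "h_num G A i = card {v \<in> nodes G. card {u. (u, v) \<in> A} = i}"

definition H_num :: "'v ugraph \<Rightarrow> nat \<Rightarrow> ('v \<times> 'v) set \<Rightarrow> nat \<Rightarrow> nat" where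
  "H_num G d A k = (\<Sum>i=0..d. h_num G A i * (i choose k))"

definition is_sink :: "('v \<times> 'v) set \<Rightarrow> 'v ugraph \<Rightarrow> 'v \<Rightarrow> bool" where
  "is_sink A H v \<longleftrightarrow> v \<in> nodes H \<and> (\<forall>u. {u, v} \<in> edges H \<longrightarrow> (u, v) \<in> A)"

definition verts :: "'a::euclidean_space set \<Rightarrow> 'a set" where
  "verts P = {v. v extreme_point_of P}"

definition simple_polytope :: "nat \<Rightarrow> 'a::euclidean_space set \<Rightarrow> bool" where
  "simple_polytope d P \<longleftrightarrow> polytope P \<and> aff_dim P = int d \<and>
     (\<forall>v\<in>verts P. card {e. e edge_of P \<and> v \<in> e} = d)"

text \<open>An edge of \<open>P\<close> is a one-dimensional face and hence a segment between two distinct vertices;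
  see \<open>simple_graph_poly_graph\<close>.\<close>

definition poly_graph :: "'a::euclidean_space set \<Rightarrow> 'a ugraph" where
  "poly_graph P = \<lparr>nodes = verts P, edges = {{u, v} | u v. closed_segment u v edge_of P}\<rparr>"

definition k_faces :: "nat \<Rightarrow> 'a::euclidean_space set \<Rightarrow> 'a set set" where
  "k_faces k P = {F. F face_of P \<and> aff_dim F = int k}"

definition face_vertex_sets :: "nat \<Rightarrow> 'a::euclidean_space set \<Rightarrow> 'a set set" where
  "face_vertex_sets k P = verts ` k_faces k P"

definition f_num :: "nat \<Rightarrow> 'a::euclidean_space set \<Rightarrow> nat" where
  "f_num k P = card (k_faces k P)"

definition k_frame :: "nat \<Rightarrow> 'a::euclidean_space set \<Rightarrow> 'a ugraph \<Rightarrow> bool" where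
  "k_frame k P H \<longleftrightarrow> is_subgraph H (poly_graph P) \<and> graph_isomorphic H (star k)"

definition k_system :: "nat \<Rightarrow> 'a::euclidean_space set \<Rightarrow> 'a set set \<Rightarrow> bool" where
  "k_system k P \<S> \<longleftrightarrow>
     (\<forall>S\<in>\<S>. S \<noteq> {} \<and> S \<subseteq> verts P \<and> regular k (induced (poly_graph P) S)) \<and>
     (\<forall>H. k_frame k P H \<longrightarrow> (\<exists>!S. S \<in> \<S> \<and> nodes H \<subseteq> S))"

lemma simple_graph_poly_graph:
  assumes "polytope P"
  shows "simple_graph (poly_graph P)"
proof -
  have fin: "finite (verts P)"
    unfolding verts_def using assms finite_polyhedron_extreme_points polytope_imp_polyhedron by blast
  have "{u, v} \<subseteq> verts P \<and> card {u, v} = 2" if e: "closed_segment u v edge_of P" for u v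
  proof -
    have face: "closed_segment u v face_of P" and dim: "aff_dim (closed_segment u v) = 1"
      using e by (auto simp: edge_of_def)
    have "u \<noteq> v" using dim by auto
    moreover have "u extreme_point_of closed_segment u v" "v extreme_point_of closed_segment u v"
      by (auto simp: extreme_point_of_segment)
    ultimately show ?thesis
      using extreme_point_of_face[OF face] by (auto simp: verts_def)
  qed
  with fin show ?thesis
    by (auto simp: simple_graph_def poly_graph_def)
qed

text \<open>Faces are determined by their vertices, so the number of \<open>k\<close>-faces is also the number
  of vertex sets of \<open>k\<close>-faces.\<close>

lemma f_num_eq:
  assumes "polytope P"
  shows "f_num k P = card (face_vertex_sets k P)"
proof -
  have "F = convex hull (verts F)" if "F \<in> k_faces k P" for F
  proof -
    have "polytope F"
      using that assms face_of_polytope_polytope by (auto simp: k_faces_def)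
    then show ?thesis
      unfolding verts_def by (intro Krein_Milman_Minkowski polytope_imp_compact polytope_imp_convex)
  qed
  then have "inj_on verts (k_faces k P)"
    by (metis inj_onI)
  then show ?thesis
    by (simp add: f_num_def face_vertex_sets_def card_image)
qed

end

theory Submission
  imports Defs
begin

text \<open>Call a family of node sets a frame system if each set induces a \<open>k\<close>-regular graph and each node
  together with \<open>k\<close> of its neighbours lies in a unique set of the family. For an acyclic
  orientation, a vertex with \<open>i\<close> incoming arcs is a sink of exactly \<open>i choose k\<close> members of a frame
  system, so \<open>H\<^sub>k\<close> counts the pairs of a member and a sink in it; each member has a sink. Both the
  given \<open>k\<close>-system and, as \<open>P\<close> is simple, the vertex sets of the \<open>k\<close>-faces are frame systems. This
  yields the second inequality and its equality case.

  The orientation of a generic linear functional has a unique sink on each face, since \<open>P\<close> lies in the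
  cone spanned by the edges at a vertex; so \<open>H\<^sub>k\<close> equals \<open>f\<^sub>k\<close> for it, which gives the first
  inequality. If that is an equality, then each member \<open>S\<close> of the system has a unique sink under
  every generic functional. Let \<open>v \<in> S\<close>, let \<open>F\<close> be the \<open>k\<close>-face containing \<open>v\<close> and its
  neighbours in \<open>S\<close>, and choose a functional for which \<open>F\<close> comes lowest and \<open>v\<close> is highest on \<open>F\<close>. Then \<open>v\<close>
  is a sink of \<open>S\<close>, hence the highest point of \<open>S\<close>, so \<open>S\<close> lies in \<open>F\<close>. By regularity no edge of
  \<open>F\<close> leaves \<open>S\<close>, and the remaining vertices of \<open>F\<close> would contain a second sink of \<open>F\<close>.\<close>

subsection \<open>Counting sinks in graphs\<close>

definition nbrs :: "'v ugraph \<Rightarrow> 'v \<Rightarrow> 'v set" where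
  "nbrs G v = {u. {u, v} \<in> edges G}"

text \<open>A frame is encoded as a root with a set of \<open>k\<close> neighbours, so that no
  isomorphism with a star is involved and the vertex sets of faces are treated in the same way as a
  \<open>k\<close>-system.\<close>

definition frame_system :: "nat \<Rightarrow> 'v ugraph \<Rightarrow> 'v set set \<Rightarrow> bool" where
  "frame_system k G \<S> \<longleftrightarrow>
     (\<forall>S\<in>\<S>. S \<noteq> {} \<and> S \<subseteq> nodes G \<and> (\<forall>v\<in>S. card (nbrs G v \<inter> S) = k)) \<and>
     (\<forall>v\<in>nodes G. \<forall>I\<subseteq>nbrs G v. card I = k \<longrightarrow> (\<exists>!S. S \<in> \<S> \<and> insert v I \<subseteq> S))"

lemma simple_graph_nbrs:
  assumes "simple_graph G"
  shows "nbrs G v \<subseteq> nodes G" "v \<notin> nbrs G v" "finite (nbrs G v)"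
proof -
  show *: "nbrs G v \<subseteq> nodes G"
    using assms by (auto simp: nbrs_def simple_graph_def)
  show "finite (nbrs G v)"
    using * assms finite_subset by (auto simp: simple_graph_def)
  show "v \<notin> nbrs G v"
    using assms by (force simp: nbrs_def simple_graph_def)
qed

lemma nbrs_sym: "u \<in> nbrs G v \<longleftrightarrow> v \<in> nbrs G u"
  by (simp add: nbrs_def insert_commute)

lemma frame_systemI:
  assumes "\<And>S. S \<in> \<S> \<Longrightarrow> S \<noteq> {} \<and> S \<subseteq> nodes G \<and> (\<forall>v\<in>S. card (nbrs G v \<inter> S) = k)"
    and "\<And>v I. v \<in> nodes G \<Longrightarrow> I \<subseteq> nbrs G v \<Longrightarrow> card I = k \<Longrightarrow> \<exists>!S. S \<in> \<S> \<and> insert v I \<subseteq> S"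
  shows "frame_system k G \<S>"
  using assms by (simp add: frame_system_def)

lemma frame_system_card:
  assumes "frame_system k G \<S>" "S \<in> \<S>" "v \<in> S"
  shows "card (nbrs G v \<inter> S) = k"
  using assms unfolding frame_system_def by metis

lemma frame_system_unique:
  assumes "frame_system k G \<S>" "v \<in> nodes G" "I \<subseteq> nbrs G v" "card I = k"
  shows "\<exists>!S. S \<in> \<S> \<and> insert v I \<subseteq> S"
  using assms unfolding frame_system_def by metis

lemma is_sink_induced:
  "is_sink A (induced G S) v \<longleftrightarrow> v \<in> S \<and> nbrs G v \<inter> S \<subseteq> {u. (u, v) \<in> A}"
  by (auto simp: is_sink_def induced_def nbrs_def)

text \<open>Every edge has two elements, so the map from \<open>u\<close> to \<open>{u, v}\<close>
  matches the neighbours of \<open>v\<close> in \<open>S\<close> with the induced edges at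
  \<open>v\<close>.\<close>

lemma regular_induced_iff:
  assumes "simple_graph G"
  shows "regular k (induced G S) \<longleftrightarrow> (\<forall>v\<in>S. card (nbrs G v \<inter> S) = k)"
proof -
  have "card {e \<in> edges (induced G S). v \<in> e} = card (nbrs G v \<inter> S)" if "v \<in> S" for v
  proof -
    have "bij_betw (\<lambda>u. {u, v}) (nbrs G v \<inter> S) {e \<in> edges (induced G S). v \<in> e}"
    proof (rule bij_betw_imageI)
      show "inj_on (\<lambda>u. {u, v}) (nbrs G v \<inter> S)"
        by (auto simp: inj_on_def doubleton_eq_iff)
      show "(\<lambda>u. {u, v}) ` (nbrs G v \<inter> S) = {e \<in> edges (induced G S). v \<in> e}"
      proof
        show "(\<lambda>u. {u, v}) ` (nbrs G v \<inter> S) \<subseteq> {e \<in> edges (induced G S). v \<in> e}"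
          using that by (auto simp: nbrs_def induced_def)
        show "{e \<in> edges (induced G S). v \<in> e} \<subseteq> (\<lambda>u. {u, v}) ` (nbrs G v \<inter> S)"
        proof
          fix e assume "e \<in> {e \<in> edges (induced G S). v \<in> e}"
          then have e: "e \<in> edges G" "e \<subseteq> S" "v \<in> e"
            by (auto simp: induced_def)
          then have "card e = 2"
            using assms by (auto simp: simple_graph_def)
          with e obtain u where "e = {u, v}"
            by (auto simp: card_2_iff)
          with e show "e \<in> (\<lambda>u. {u, v}) ` (nbrs G v \<inter> S)"
            by (auto simp: nbrs_def)
        qed
      qed
    qed
    then show ?thesis
      by (metis bij_betw_same_card)
  qed
  then show ?thesis
    by (simp add: regular_def induced_def)
qed

text \<open>Intersection with the neighbourhood of \<open>v\<close> matches these members with the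
  \<open>k\<close>-subsets of the in-neighbours of \<open>v\<close>. Injectivity comes from the
  uniqueness of the member through a frame, surjectivity from its existence.\<close>

lemma card_sinking_sets:
  assumes G: "simple_graph G" and A: "orientation G A" and sys: "frame_system k G \<S>"
    and v: "v \<in> nodes G"
  shows "card {S \<in> \<S>. is_sink A (induced G S) v} = card {u. (u, v) \<in> A} choose k"
proof -
  let ?In = "{u. (u, v) \<in> A}"
  have sub: "?In \<subseteq> nbrs G v"
    using A by (auto simp: orientation_def nbrs_def)
  then have fin: "finite ?In"
    using simple_graph_nbrs(3)[OF G] finite_subset by blast
  have "bij_betw (\<lambda>S. nbrs G v \<inter> S) {S \<in> \<S>. is_sink A (induced G S) v}
      {I. I \<subseteq> ?In \<and> card I = k}"
  proof (rule bij_betw_imageI)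
    show "inj_on (\<lambda>S. nbrs G v \<inter> S) {S \<in> \<S>. is_sink A (induced G S) v}"
    proof (rule inj_onI)
      fix S T
      assume S: "S \<in> {S \<in> \<S>. is_sink A (induced G S) v}"
        and T: "T \<in> {S \<in> \<S>. is_sink A (induced G S) v}"
        and eq: "nbrs G v \<inter> S = nbrs G v \<inter> T"
      have "card (nbrs G v \<inter> S) = k"
        using S frame_system_card[OF sys] by (simp add: is_sink_induced)
      then have "\<exists>!U. U \<in> \<S> \<and> insert v (nbrs G v \<inter> S) \<subseteq> U"
        using frame_system_unique[OF sys v] by simp
      moreover have "insert v (nbrs G v \<inter> S) \<subseteq> S" "insert v (nbrs G v \<inter> S) \<subseteq> T"
        using S T eq by (auto simp: is_sink_induced)
      ultimately show "S = T"
        using S T by blast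
    qed
    show "(\<lambda>S. nbrs G v \<inter> S) ` {S \<in> \<S>. is_sink A (induced G S) v} = {I. I \<subseteq> ?In \<and> card I = k}"
    proof
      show "(\<lambda>S. nbrs G v \<inter> S) ` {S \<in> \<S>. is_sink A (induced G S) v}
          \<subseteq> {I. I \<subseteq> ?In \<and> card I = k}"
        using frame_system_card[OF sys] by (auto simp: is_sink_induced)
      show "{I. I \<subseteq> ?In \<and> card I = k}
          \<subseteq> (\<lambda>S. nbrs G v \<inter> S) ` {S \<in> \<S>. is_sink A (induced G S) v}"
      proof
        fix I assume "I \<in> {I. I \<subseteq> ?In \<and> card I = k}"
        then have I: "I \<subseteq> ?In" "card I = k"
          by auto
        then have "I \<subseteq> nbrs G v"
          using sub by blast
        then obtain S where S: "S \<in> \<S>" "insert v I \<subseteq> S"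
          using frame_system_unique[OF sys v] I by blast
        then have "card (nbrs G v \<inter> S) = k"
          using frame_system_card[OF sys] by simp
        \<comment> \<open>Both sets have \<open>k\<close> elements and one contains the other:
          regularity leaves no room in \<open>S\<close> for a further neighbour of
          \<open>v\<close>.\<close>
        then have "I = nbrs G v \<inter> S"
          using I S \<open>I \<subseteq> nbrs G v\<close> simple_graph_nbrs(3)[OF G]
          by (intro card_subset_eq) auto
        then show "I \<in> (\<lambda>S. nbrs G v \<inter> S) ` {S \<in> \<S>. is_sink A (induced G S) v}"
          using S I by (auto simp: is_sink_induced)
      qed
    qed
  qed
  then have "card {S \<in> \<S>. is_sink A (induced G S) v} = card {I. I \<subseteq> ?In \<and> card I = k}"
    by (rule bij_betw_same_card)
  also have "\<dots> = card ?In choose k"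
    using n_subsets[OF fin] by simp
  finally show ?thesis .
qed

lemma H_num_eq_sum:
  assumes G: "simple_graph G" and A: "orientation G A"
    and deg: "\<And>v. v \<in> nodes G \<Longrightarrow> card (nbrs G v) \<le> d"
  shows "H_num G d A k = (\<Sum>v\<in>nodes G. card {u. (u, v) \<in> A} choose k)"
proof -
  let ?f = "\<lambda>v. card {u. (u, v) \<in> A}"
  have fin: "finite (nodes G)"
    using G by (simp add: simple_graph_def)
  \<comment> \<open>This puts every in-degree within the range of the sum in \<open>H_num\<close>,
    so grouping the vertices by in-degree loses none.\<close>
  have "?f v \<le> d" if "v \<in> nodes G" for v
  proof -
    have "{u. (u, v) \<in> A} \<subseteq> nbrs G v"
      using A by (auto simp: orientation_def nbrs_def)
    then have "?f v \<le> card (nbrs G v)"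
      using simple_graph_nbrs(3)[OF G] card_mono by blast
    then show ?thesis
      using deg[OF that] by linarith
  qed
  then have sub: "?f ` nodes G \<subseteq> {0..d}"
    by auto
  have "(\<Sum>v\<in>nodes G. ?f v choose k) = (\<Sum>i=0..d. \<Sum>v\<in>{v\<in>nodes G. ?f v = i}. ?f v choose k)"
    using sum.group[OF fin finite_atLeastAtMost sub, of "\<lambda>v. ?f v choose k"] by simp
  also have "\<dots> = H_num G d A k"
    by (simp add: H_num_def h_num_def)
  finally show ?thesis by simp
qed

text \<open>Double counting of the pairs of a member and a sink of it: by vertex, through
  \<open>card_sinking_sets\<close>, and by member.\<close>

lemma H_num_eq_sum_sinks:
  assumes G: "simple_graph G" and A: "orientation G A" and sys: "frame_system k G \<S>"
    and deg: "\<And>v. v \<in> nodes G \<Longrightarrow> card (nbrs G v) \<le> d"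
  shows "H_num G d A k = (\<Sum>S\<in>\<S>. card {v. is_sink A (induced G S) v})"
proof -
  have fin: "finite (nodes G)"
    using G by (simp add: simple_graph_def)
  have sub: "\<S> \<subseteq> Pow (nodes G)"
    using sys by (auto simp: frame_system_def)
  then have finS: "finite \<S>"
    using fin by (simp add: finite_subset)
  have "H_num G d A k = (\<Sum>v\<in>nodes G. card {S \<in> \<S>. is_sink A (induced G S) v})"
    using card_sinking_sets[OF G A sys] H_num_eq_sum[OF G A deg] by simp
  also have "\<dots> = (\<Sum>S\<in>\<S>. card {v \<in> nodes G. is_sink A (induced G S) v})"
    using sum.swap_restrict[OF fin finS, of "\<lambda>_ _. 1::nat" "\<lambda>v S. is_sink A (induced G S) v"]
    by simp
  also have "\<dots> = (\<Sum>S\<in>\<S>. card {v. is_sink A (induced G S) v})"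
    using sub by (intro sum.cong refl arg_cong[where f = card]) (auto simp: is_sink_induced)
  finally show ?thesis .
qed

text \<open>The converse of a finite acyclic relation is well-founded. A minimal node of
  \<open>S\<close> for it has no outgoing arc inside \<open>S\<close>, so all its edges inside
  \<open>S\<close> point inwards.\<close>

lemma sink_exists:
  assumes A: "acyclic_orientation G A" and S: "finite S" "S \<noteq> {}"
  shows "\<exists>v. is_sink A (induced G S) v"
proof -
  have "acyclic (A \<inter> S \<times> S)"
    using A by (auto simp: acyclic_orientation_def intro: acyclic_subset)
  then have "wf ((A \<inter> S \<times> S)\<inverse>)"
    using S by (intro finite_acyclic_wf_converse) auto
  then obtain v where v: "v \<in> S" "\<And>u. (u, v) \<in> (A \<inter> S \<times> S)\<inverse> \<Longrightarrow> u \<notin> S"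
    using wfE_min[of "(A \<inter> S \<times> S)\<inverse>" _ S] S(2) by blast
  have "(u, v) \<in> A" if "u \<in> nbrs G v" "u \<in> S" for u
  proof -
    have "(u, v) \<in> A \<longleftrightarrow> (v, u) \<notin> A"
      using that A unfolding acyclic_orientation_def orientation_def nbrs_def by blast
    moreover have "(v, u) \<notin> A"
      using v that by blast
    ultimately show ?thesis
      by blast
  qed
  then show ?thesis
    using v(1) by (auto simp: is_sink_induced)
qed

lemma sum_ge_card_nat:
  fixes f :: "'b \<Rightarrow> nat"
  assumes "finite B" and "\<And>x. x \<in> B \<Longrightarrow> 1 \<le> f x"
  shows "card B \<le> sum f B" and "card B = sum f B \<longleftrightarrow> (\<forall>x\<in>B. f x = 1)"
proof -
  show le: "card B \<le> sum f B"
    using sum_mono[of B "\<lambda>_. 1" f] assms by simp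
  \<comment> \<open>Each value is split into 1 and its excess. All values are at least 1, so the
    truncated subtraction is exact.\<close>
  have "sum f B = card B + (\<Sum>x\<in>B. f x - 1)"
  proof -
    have "sum f B = (\<Sum>x\<in>B. 1 + (f x - 1))"
      using assms by (intro sum.cong) (auto dest: assms(2))
    then show ?thesis by (simp only: sum.distrib) simp
  qed
  then have "card B = sum f B \<longleftrightarrow> (\<forall>x\<in>B. f x - 1 = 0)"
    using assms by simp
  also have "\<dots> \<longleftrightarrow> (\<forall>x\<in>B. f x = 1)"
  proof (intro ball_cong refl)
    fix x assume "x \<in> B"
    then show "f x - 1 = 0 \<longleftrightarrow> f x = 1"
      using assms(2)[of x] by arith
  qed
  finally show "card B = sum f B \<longleftrightarrow> (\<forall>x\<in>B. f x = 1)" .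
qed

text \<open>Every member contributes at least one sink to \<open>H_num\<close>; the difference of
  the two numbers counts the additional sinks.\<close>

lemma frame_system_card_le_H_num:
  assumes G: "simple_graph G" and A: "acyclic_orientation G A" and sys: "frame_system k G \<S>"
    and deg: "\<And>v. v \<in> nodes G \<Longrightarrow> card (nbrs G v) \<le> d"
  shows "card \<S> \<le> H_num G d A k"
    and "card \<S> = H_num G d A k \<longleftrightarrow> (\<forall>S\<in>\<S>. \<exists>!v. is_sink A (induced G S) v)"
proof -
  have fin: "finite (nodes G)"
    using G by (simp add: simple_graph_def)
  have sub: "\<S> \<subseteq> Pow (nodes G)"
    using sys by (auto simp: frame_system_def)
  then have finS: "finite \<S>"
    using fin by (simp add: finite_subset)
  have eq: "H_num G d A k = (\<Sum>S\<in>\<S>. card {v. is_sink A (induced G S) v})"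
    using A by (intro H_num_eq_sum_sinks[OF G _ sys deg]) (auto simp: acyclic_orientation_def)
  have ge1: "1 \<le> card {v. is_sink A (induced G S) v}" if "S \<in> \<S>" for S
  proof -
    have S: "finite S" "S \<noteq> {}"
      using that sub fin sys by (auto simp: frame_system_def intro: finite_subset)
    have "finite {v. is_sink A (induced G S) v}"
      using S by (auto simp: is_sink_induced)
    moreover have "{v. is_sink A (induced G S) v} \<noteq> {}"
      using sink_exists[OF A S] by blast
    ultimately show ?thesis
      by (simp add: Suc_le_eq card_gt_0_iff)
  qed
  show "card \<S> \<le> H_num G d A k"
    using sum_ge_card_nat(1)[OF finS ge1] eq by simp
  have "(card {v. Q v} = 1) = (\<exists>!v. Q v)" for Q :: "'a \<Rightarrow> bool"
    by (simp add: card_1_singleton_iff Ex1_def set_eq_iff) blast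
  then show "card \<S> = H_num G d A k \<longleftrightarrow> (\<forall>S\<in>\<S>. \<exists>!v. is_sink A (induced G S) v)"
    using sum_ge_card_nat(2)[OF finS ge1] eq by simp
qed

text \<open>Arcs strictly increase \<open>f\<close>, which excludes cycles, and injectivity gives
  each edge exactly one direction.\<close>

lemma acyclic_orientation_of_injection:
  fixes f :: "'v \<Rightarrow> 'b::linorder"
  assumes G: "simple_graph G" and inj: "inj_on f (nodes G)"
  shows "acyclic_orientation G {(u, v). {u, v} \<in> edges G \<and> f u < f v}"
    (is "acyclic_orientation G ?A")
proof -
  have "?A \<subseteq> inv_image {(x, y). x < y} f"
    by auto
  moreover have "acyclic (inv_image {(x, y). x < y} f)"
  proof -
    have "trans (inv_image {(x :: 'b, y). x < y} f)"
      by (auto intro: trans_inv_image transI)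
    then show ?thesis
      by (auto simp: acyclic_def)
  qed
  ultimately have "acyclic ?A"
    using acyclic_subset by blast
  have "(u, v) \<in> ?A \<longleftrightarrow> (v, u) \<notin> ?A" if "{u, v} \<in> edges G" for u v
  proof -
    have "u \<in> nodes G" "v \<in> nodes G" "u \<noteq> v"
      using that G by (fastforce simp: simple_graph_def)+
    then have "f u \<noteq> f v"
      using inj by (auto simp: inj_on_def)
    moreover have "{v, u} = {u, v}"
      by blast
    ultimately show ?thesis
      using that by auto
  qed
  then have "orientation G ?A"
    unfolding orientation_def by blast
  with \<open>acyclic ?A\<close> show ?thesis
    by (simp add: acyclic_orientation_def)
qed

subsection \<open>Edges and faces at a vertex\<close>

lemma nbrs_poly_graph: "nbrs (poly_graph P) v = {u. closed_segment v u edge_of P}"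
proof -
  have "closed_segment v u edge_of P" if "{u, v} \<in> edges (poly_graph P)" for u
  proof -
    have "{u, v} \<in> {{x, y} | x y. closed_segment x y edge_of P}"
      using that by (simp add: poly_graph_def)
    then obtain x y where "{u, v} = {x, y}" "closed_segment x y edge_of P"
      by blast
    then show ?thesis
      by (metis closed_segment_commute doubleton_eq_iff)
  qed
  moreover have "{u, v} \<in> edges (poly_graph P)" if "closed_segment v u edge_of P" for u
    using that unfolding poly_graph_def by (auto intro: exI[of _ v] exI[of _ u])
  ultimately show ?thesis
    by (auto simp: nbrs_def)
qed

lemma nbrs_poly_graph_subset:
  assumes "polytope P"
  shows "nbrs (poly_graph P) v \<subseteq> verts P"
  using simple_graph_nbrs(1)[OF simple_graph_poly_graph[OF assms]] by (simp add: poly_graph_def)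

lemma finite_nbrs_poly_graph:
  assumes "polytope P"
  shows "finite (nbrs (poly_graph P) v)"
  using simple_graph_nbrs(3)[OF simple_graph_poly_graph[OF assms]] .

text \<open>A one-dimensional compact convex set is a segment, and the extreme point
  \<open>v\<close> must be one of its ends.\<close>

lemma polytope_edge_segment:
  assumes "polytope P" "v \<in> verts P" "e edge_of P" "v \<in> e"
  obtains u where "e = closed_segment v u"
proof -
  have face: "e face_of P" and dim: "aff_dim e = 1"
    using assms(3) by (auto simp: edge_of_def)
  have "polytope e"
    using face_of_polytope_polytope[OF assms(1) face] .
  then obtain a b where e: "e = closed_segment a b"
    using compact_convex_collinear_segment[of e] dim assms(4)
    by (metis collinear_aff_dim empty_iff order_refl polytope_imp_compact polytope_imp_convex)
  have "v extreme_point_of e"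
    using assms(2,4) face by (simp add: extreme_point_of_face verts_def)
  then have "v = a \<or> v = b"
    using e by (simp add: extreme_point_of_segment)
  then show thesis
    using that e closed_segment_commute by metis
qed

lemma card_edges_at_vertex:
  assumes "polytope P" "v \<in> verts P"
  shows "card {e. e edge_of P \<and> v \<in> e} = card (nbrs (poly_graph P) v)"
proof -
  have "bij_betw (closed_segment v) (nbrs (poly_graph P) v) {e. e edge_of P \<and> v \<in> e}"
  proof (rule bij_betw_imageI)
    show "inj_on (closed_segment v) (nbrs (poly_graph P) v)"
      by (auto simp: inj_on_def closed_segment_eq doubleton_eq_iff)
    show "closed_segment v ` nbrs (poly_graph P) v = {e. e edge_of P \<and> v \<in> e}"
      using polytope_edge_segment[OF assms] by (auto simp: nbrs_poly_graph image_iff)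
  qed
  then show ?thesis
    by (simp add: bij_betw_same_card)
qed

section \<open>Vertices, hyperplane sections and the cone at a vertex\<close>

lemma finite_verts: "polytope P \<Longrightarrow> finite (verts P)"
  unfolding verts_def
  using finite_polyhedron_extreme_points polytope_imp_polyhedron by blast

lemma polytope_eq_hull_verts: "polytope P \<Longrightarrow> P = convex hull verts P"
  unfolding verts_def by (intro Krein_Milman_Minkowski polytope_imp_compact polytope_imp_convex)

lemma verts_subset: "verts P \<subseteq> P"
  by (auto simp: verts_def extreme_point_of_def)

lemma verts_face: "F face_of P \<Longrightarrow> verts F = verts P \<inter> F"
  by (auto simp: verts_def extreme_point_of_face)

text \<open>A face of least dimension containing \<open>q\<close> works: on its relative boundary,
  \<open>q\<close> would lie in a facet of it, which is a smaller face of \<open>P\<close>.\<close>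

lemma polytope_in_rel_interior_of_face:
  fixes P :: "'a::euclidean_space set"
  assumes "polytope P" "q \<in> P"
  obtains G where "G face_of P" "q \<in> rel_interior G"
proof -
  have "\<exists>G. G face_of P \<and> q \<in> G"
    using assms polytope_imp_convex face_of_refl by blast
  then obtain G where G: "G face_of P" "q \<in> G"
      and min: "\<And>H. H face_of P \<Longrightarrow> q \<in> H \<Longrightarrow> nat (aff_dim G) \<le> nat (aff_dim H)"
    using exists_least_iff[of "\<lambda>n. \<exists>G. G face_of P \<and> q \<in> G \<and> nat (aff_dim G) = n"]
    by (metis linorder_not_le)
  have "q \<in> rel_interior G"
  proof (rule ccontr)
    assume "q \<notin> rel_interior G"
    moreover have "polyhedron G"
      using assms(1) G(1) face_of_polytope_polytope polytope_imp_polyhedron by blast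
    ultimately obtain F where F: "F facet_of G" "q \<in> F"
      using rel_boundary_of_polyhedron[of G] G(2) by blast
    then have "F face_of P" "aff_dim F = aff_dim G - 1"
      using face_of_trans[OF facet_of_imp_face_of G(1)] by (auto simp: facet_of_def)
    \<comment> \<open>Nonnegativity ensures that the drop in dimension survives the conversion by
      \<open>nat\<close>.\<close>
    moreover have "aff_dim F \<ge> 0"
      using F(2) aff_dim_negative_iff[of F] by (metis empty_iff not_le)
    ultimately show False
      using min[of F] F(2) by linarith
  qed
  with G that show thesis by blast
qed

text \<open>Let \<open>G\<close> be the face with \<open>q\<close> in its relative interior.
  Extremality of \<open>q\<close> forces the hyperplane to meet the affine hull of \<open>G\<close>
  in \<open>q\<close> alone, so \<open>G\<close> has dimension at most 1; dimension 0 would make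
  \<open>q\<close> a vertex on the hyperplane.\<close>

lemma extreme_point_of_section:
  assumes P: "polytope P" and c: "\<And>w. w \<in> verts P \<Longrightarrow> a \<bullet> w \<noteq> c"
    and q: "q extreme_point_of (P \<inter> {x. a \<bullet> x = c})"
  obtains G where "G edge_of P" "q \<in> G"
proof -
  have qP: "q \<in> P" and qc: "a \<bullet> q = c"
    using q by (auto simp: extreme_point_of_def)
  obtain G where G: "G face_of P" "q \<in> rel_interior G"
    using polytope_in_rel_interior_of_face[OF P qP] .
  have convG: "convex G"
    using G(1) face_of_imp_convex by blast
  have qG: "q \<in> G"
    using G(2) rel_interior_subset by blast
  have GP: "G \<subseteq> P"
    using G(1) face_of_imp_subset by blast
  have eqG: "y = q" if y: "y \<in> G" "a \<bullet> y = c" for y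
  proof (rule ccontr)
    assume ne: "y \<noteq> q"
    \<comment> \<open>The segment from \<open>y\<close> to \<open>q\<close> is prolonged beyond
      \<open>q\<close> inside \<open>G\<close>, which places \<open>q\<close> strictly between two
      points of the section.\<close>
    obtain m where m: "m > 1" "(1 - m) *\<^sub>R y + m *\<^sub>R q \<in> G"
      using convex_rel_interior_if[OF convG G(2)] y(1) hull_inc by (metis order_refl)
    let ?z = "(1 - m) *\<^sub>R y + m *\<^sub>R q"
    have "a \<bullet> ?z = c"
      using y(2) qc by (simp add: inner_add_right algebra_simps)
    moreover have "q \<in> open_segment y ?z"
    proof -
      have "q = (1 - 1 / m) *\<^sub>R y + (1 / m) *\<^sub>R ?z"
      proof -
        have "(1 / m) *\<^sub>R ?z = (1 / m - 1) *\<^sub>R y + q"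
          using m(1) by (simp add: scaleR_add_right diff_divide_distrib)
        then have "(1 - 1 / m) *\<^sub>R y + (1 / m) *\<^sub>R ?z = ((1 - 1 / m) + (1 / m - 1)) *\<^sub>R y + q"
          by (simp only: scaleR_add_left add.assoc)
        then show ?thesis
          by simp
      qed
      moreover have "y \<noteq> ?z"
      proof
        assume "y = ?z"
        then have "m *\<^sub>R (y - q) = 0"
          by (simp add: algebra_simps)
        then show False
          using ne m(1) by simp
      qed
      ultimately show ?thesis
        using m(1) unfolding in_segment by (intro conjI exI[of _ "1/m"]) auto
    qed
    ultimately show False
      using q y m(2) GP by (auto simp: extreme_point_of_def)
  qed
  have "affine hull G \<inter> {x. a \<bullet> x = c} = {q}"
  proof
    show "{q} \<subseteq> affine hull G \<inter> {x. a \<bullet> x = c}"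
      using qG qc hull_inc by force
    show "affine hull G \<inter> {x. a \<bullet> x = c} \<subseteq> {q}"
    proof
      fix y assume "y \<in> affine hull G \<inter> {x. a \<bullet> x = c}"
      then have y: "y \<in> affine hull G" "a \<bullet> y = c"
        by auto
      \<comment> \<open>Here \<open>y\<close> may lie outside \<open>G\<close>, but the prolonged
        point lies in \<open>G\<close> and on the hyperplane, so it equals \<open>q\<close> by
        \<open>eqG\<close>.\<close>
      obtain m where m: "m > 1" "(1 - m) *\<^sub>R y + m *\<^sub>R q \<in> G"
        using convex_rel_interior_if[OF convG G(2)] y(1) by (metis order_refl)
      have "a \<bullet> ((1 - m) *\<^sub>R y + m *\<^sub>R q) = c"
        using y(2) qc by (simp add: inner_add_right algebra_simps)
      then have "(1 - m) *\<^sub>R y + m *\<^sub>R q = q"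
        using eqG m(2) by blast
      then have "(1 - m) *\<^sub>R (y - q) = 0"
        by (simp add: algebra_simps)
      then show "y \<in> {q}"
        using m(1) by simp
    qed
  qed
  then have dim0: "aff_dim (affine hull G \<inter> {x. a \<bullet> x = c}) = 0"
    by simp
  have "\<not> affine hull G \<subseteq> {x. a \<bullet> x = c}"
  proof
    assume "affine hull G \<subseteq> {x. a \<bullet> x = c}"
    then have "G = {q}"
      using eqG qG hull_subset[of G affine] by blast
    then have "q \<in> verts P"
      using G(1) by (simp add: face_of_singleton verts_def)
    then show False
      using c qc by blast
  qed
  then have "aff_dim G = 1"
    using dim0 aff_dim_affine_Int_hyperplane[of "affine hull G" a c]
    by (auto split: if_splits)
  then have "G edge_of P"
    using G(1) by (simp add: edge_of_def)
  then show thesis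
    using that qG by blast
qed

text \<open>The hyperplane \<open>{x. a \<bullet> x = c}\<close> below cuts off the vertex \<open>v\<close>. The extreme points of the section
  (the vertex figure) lie on the edges at \<open>v\<close>, and every other vertex is seen from \<open>v\<close> through a
  point of the section.\<close>

lemma polytope_subset_vertex_cone:
  assumes P: "polytope P" and v: "v \<in> verts P" and x: "x \<in> P"
  shows "x - v \<in> convex_cone hull ((\<lambda>u. u - v) ` nbrs (poly_graph P) v)"
proof -
  define C where "C = convex_cone hull ((\<lambda>u. u - v) ` nbrs (poly_graph P) v)"
  have C0: "0 \<in> C" and Cmul: "\<And>t x. x \<in> C \<Longrightarrow> 0 \<le> t \<Longrightarrow> t *\<^sub>R x \<in> C"
    and Cinc: "\<And>u. closed_segment v u edge_of P \<Longrightarrow> u - v \<in> C"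
    by (auto simp: C_def convex_cone_hull_contains_0 convex_cone_hull_mul nbrs_poly_graph
        intro!: hull_inc)
  have convC: "convex {x. x - v \<in> C}"
  proof -
    have "{x. x - v \<in> C} = (\<lambda>x. v + x) ` C"
      by (auto simp: image_iff algebra_simps intro!: bexI[of _ "_ - v"])
    then show ?thesis
      by (simp add: C_def convex_convex_cone_hull convex_translation)
  qed
  have "{v} face_of P"
    using v by (simp add: verts_def face_of_singleton)
  then obtain a b where ab: "P \<subseteq> {x. a \<bullet> x \<le> b}" "{v} = P \<inter> {x. a \<bullet> x = b}"
    using exposed_face_of_polyhedron[OF polytope_imp_polyhedron[OF P]]
    unfolding exposed_face_of_def by metis
  have av: "a \<bullet> v = b"
    using ab(2) by blast
  have less: "a \<bullet> w < b" if "w \<in> verts P - {v}" for w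
  proof -
    have "w \<in> P" "w \<noteq> v"
      using that verts_subset by auto
    then show ?thesis
      using ab by (metis (mono_tags, lifting) IntI mem_Collect_eq order_le_less singletonD subsetD)
  qed
  obtain c where c: "c < b" "\<And>w. w \<in> verts P - {v} \<Longrightarrow> a \<bullet> w < c"
  proof -
    \<comment> \<open>The entry \<open>b - 1\<close> keeps the maximum defined, and below
      \<open>b\<close>, when \<open>v\<close> is the only vertex.\<close>
    let ?M = "Max (insert (b - 1) ((\<lambda>w. a \<bullet> w) ` (verts P - {v})))"
    have fin: "finite (insert (b - 1) ((\<lambda>w. a \<bullet> w) ` (verts P - {v})))"
      using finite_verts[OF P] by simp
    then have "?M < b"
      using less by (subst Max_less_iff) auto
    moreover have "a \<bullet> w \<le> ?M" if "w \<in> verts P - {v}" for w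
      using fin that by (intro Max_ge) auto
    ultimately show thesis
      using that[of "(?M + b) / 2"] by force
  qed
  let ?Q = "P \<inter> {x. a \<bullet> x = c}"
  have "polytope ?Q"
    using P polytope_Int_polyhedron polyhedron_hyperplane by blast
  then have Q: "?Q = convex hull verts ?Q"
    by (rule polytope_eq_hull_verts)
  have vc: "a \<bullet> w \<noteq> c" if "w \<in> verts P" for w
    using c that av by (cases "w = v") force+
  have "verts ?Q \<subseteq> {x. x - v \<in> C}"
  proof
    fix q assume q: "q \<in> verts ?Q"
    then have qc: "a \<bullet> q = c"
      using verts_subset by blast
    obtain G where G: "G edge_of P" "q \<in> G"
      using extreme_point_of_section[OF P vc, of q] q by (auto simp: verts_def)
    then have "polytope G" and face: "G face_of P"
      using P face_of_polytope_polytope by (auto simp: edge_of_def)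
    \<comment> \<open>Otherwise all vertices of \<open>G\<close>, and hence \<open>G\<close> itself,
      would lie strictly below the hyperplane through \<open>q\<close>.\<close>
    have "v \<in> G"
    proof (rule ccontr)
      assume "v \<notin> G"
      then have "verts G \<subseteq> {x. a \<bullet> x < c}"
        using c verts_face[OF face] by blast
      then have "convex hull verts G \<subseteq> {x. a \<bullet> x < c}"
        by (simp add: hull_minimal convex_halfspace_lt)
      then show False
        using polytope_eq_hull_verts[OF \<open>polytope G\<close>] G(2) qc by blast
    qed
    then obtain u where u: "G = closed_segment v u"
      using polytope_edge_segment[OF P v G(1)] by blast
    then obtain t where t: "0 \<le> t" "q = (1 - t) *\<^sub>R v + t *\<^sub>R u"
      using G(2) by (auto simp: in_segment)
    have "q - v = t *\<^sub>R (u - v)"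
      using t(2) by (simp add: algebra_simps)
    then show "q \<in> {x. x - v \<in> C}"
      using Cmul[OF Cinc] t(1) G(1) u by simp
  qed
  then have "convex hull verts ?Q \<subseteq> {x. x - v \<in> C}"
    using convC by (simp add: hull_minimal)
  then have QC: "?Q \<subseteq> {x. x - v \<in> C}"
    using Q by simp
  have "verts P \<subseteq> {x. x - v \<in> C}"
  proof
    fix w assume w: "w \<in> verts P"
    show "w \<in> {x. x - v \<in> C}"
    proof (cases "w = v")
      case False
      then have wc: "a \<bullet> w < c"
        using w c by blast
      \<comment> \<open>The parameter at which the segment from \<open>v\<close> to \<open>w\<close>
        crosses the hyperplane.\<close>
      define s where "s = (b - c) / (b - a \<bullet> w)"
      have s: "0 < s" "s \<le> 1"
        using wc c(1) by (auto simp: s_def field_simps)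
      let ?p = "(1 - s) *\<^sub>R v + s *\<^sub>R w"
      have "?p \<in> P"
        using polytope_imp_convex[OF P] v w verts_subset s
        by (intro convexD) (auto simp: subset_iff)
      moreover have "a \<bullet> ?p = c"
      proof -
        have "a \<bullet> ?p = b - s * (b - a \<bullet> w)"
          by (simp add: inner_add_right av algebra_simps)
        also have "\<dots> = c"
          using wc c(1) by (simp add: s_def)
        finally show ?thesis .
      qed
      ultimately have "?p - v \<in> C"
        using QC by blast
      moreover have "w - v = (1 / s) *\<^sub>R (?p - v)"
      proof -
        have "?p - v = s *\<^sub>R (w - v)"
          by (simp add: algebra_simps)
        then show ?thesis
          using s by simp
      qed
      ultimately show ?thesis
        using Cmul[of "?p - v" "1 / s"] s by simp
    qed (simp add: C0)
  qed
  then have "convex hull verts P \<subseteq> {x. x - v \<in> C}"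
    using convC by (simp add: hull_minimal)
  then show ?thesis
    using x polytope_eq_hull_verts[OF P] by (auto simp: C_def)
qed

text \<open>A local maximum is a global one: \<open>x - v\<close> lies in the cone of the edge
  directions, on none of which \<open>a\<close> is positive.\<close>

lemma linear_functional_vertex_bound:
  assumes "polytope P" "v \<in> verts P" "x \<in> P"
    and le: "\<And>u. u \<in> nbrs (poly_graph P) v \<Longrightarrow> a \<bullet> u \<le> a \<bullet> v"
  shows "a \<bullet> x \<le> a \<bullet> v"
proof -
  have "convex_cone hull ((\<lambda>u. u - v) ` nbrs (poly_graph P) v) \<subseteq> {y. a \<bullet> y \<le> 0}"
    using le by (intro hull_minimal convex_cone_halfspace_le) (auto simp: inner_diff_right)
  then show ?thesis
    using polytope_subset_vertex_cone[OF assms(1-3)] by (auto simp: inner_diff_right)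
qed

text \<open>Convexity puts a segment into the face once both its ends are there. This makes the
  results on the edges at a vertex applicable to faces.\<close>

lemma nbrs_face:
  assumes "F face_of P" "v \<in> F"
  shows "nbrs (poly_graph F) v = nbrs (poly_graph P) v \<inter> F"
proof -
  have "closed_segment v u edge_of F \<longleftrightarrow> closed_segment v u edge_of P \<and> u \<in> F" for u
  proof
    assume "closed_segment v u edge_of F"
    then show "closed_segment v u edge_of P \<and> u \<in> F"
      using assms(1) face_of_trans edge_of_imp_subset by (fastforce simp: edge_of_def)
  next
    assume *: "closed_segment v u edge_of P \<and> u \<in> F"
    then have "closed_segment v u \<subseteq> F"
      using assms face_of_imp_convex closed_segment_subset by blast
    then show "closed_segment v u edge_of F"
      using * assms(1) by (auto simp: edge_of_def face_of_face)
  qed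
  then show ?thesis
    by (auto simp: nbrs_poly_graph)
qed

section \<open>Edges and faces at a vertex of a simple polytope\<close>

lemma simple_polytope_card_nbrs:
  assumes "simple_polytope d P" "v \<in> verts P"
  shows "card (nbrs (poly_graph P) v) = d"
  using assms card_edges_at_vertex[of P v] by (simp add: simple_polytope_def)

text \<open>The cone at \<open>v\<close> lies in the span of the edge directions, and these are
  themselves differences of points of \<open>P\<close>.\<close>

lemma aff_dim_eq_dim_edge_directions:
  assumes "polytope P" "v \<in> verts P"
  shows "aff_dim P = int (dim ((\<lambda>u. u - v) ` nbrs (poly_graph P) v))"
proof -
  let ?D = "(\<lambda>u. u - v) ` nbrs (poly_graph P) v"
  have vP: "v \<in> P"
    using assms(2) verts_subset by blast
  have "(\<lambda>x. x - v) ` P \<subseteq> span ?D"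
  proof -
    have "convex_cone hull ?D \<subseteq> span ?D"
      by (intro hull_minimal span_superset convex_cone_span)
    then show ?thesis
      using polytope_subset_vertex_cone[OF assms] by blast
  qed
  then have "dim ((\<lambda>x. x - v) ` P) \<le> dim ?D"
    using dim_subset[of _ "span ?D"] by simp
  moreover have "?D \<subseteq> (\<lambda>x. x - v) ` P"
    by (auto simp: nbrs_poly_graph edge_of_def dest!: face_of_imp_subset)
  then have "dim ?D \<le> dim ((\<lambda>x. x - v) ` P)"
    by (rule dim_subset)
  moreover have "aff_dim P = int (dim ((\<lambda>x. x - v) ` P))"
    using aff_dim_eq_dim_subtract[of v P] vP hull_inc by metis
  ultimately show ?thesis
    by linarith
qed

text \<open>There are \<open>d\<close> edge directions, and they span a space of dimension
  \<open>d\<close>.\<close>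

lemma simple_polytope_independent:
  assumes "simple_polytope d P" "v \<in> verts P"
  shows "independent ((\<lambda>u. u - v) ` nbrs (poly_graph P) v)"
proof -
  let ?D = "(\<lambda>u. u - v) ` nbrs (poly_graph P) v"
  have P: "polytope P" "aff_dim P = int d"
    using assms(1) by (auto simp: simple_polytope_def)
  have "card ?D = d"
    using simple_polytope_card_nbrs[OF assms] by (subst card_image) (auto simp: inj_on_def)
  moreover have "dim ?D = d"
    using aff_dim_eq_dim_edge_directions[OF P(1) assms(2)] P(2) by simp
  ultimately show ?thesis
    using finite_nbrs_poly_graph[OF P(1)] card_le_dim_spanning[of ?D ?D] span_superset[of ?D]
    by simp
qed

lemma simple_polytope_aff_dim_face:
  assumes "simple_polytope d P" "v \<in> verts P" "F face_of P" "v \<in> F"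
  shows "aff_dim F = int (card (nbrs (poly_graph P) v \<inter> F))"
proof -
  let ?D = "(\<lambda>u. u - v) ` (nbrs (poly_graph P) v \<inter> F)"
  have "polytope F"
    using assms(1,3) face_of_polytope_polytope by (auto simp: simple_polytope_def)
  moreover have "v \<in> verts F"
    using assms verts_face by blast
  ultimately have "aff_dim F = int (dim ?D)"
    using aff_dim_eq_dim_edge_directions nbrs_face[OF assms(3,4)] by metis
  moreover have "independent ?D"
    by (rule independent_mono[OF simple_polytope_independent[OF assms(1,2)]]) auto
  then have "dim ?D = card ?D"
    by (rule dim_eq_card_independent)
  moreover have "card ?D = card (nbrs (poly_graph P) v \<inter> F)"
    by (intro card_image) (auto simp: inj_on_def)
  ultimately show ?thesis by simp
qed

text \<open>Independence allows a functional to be prescribed on the edge directions: 0 towards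
  \<open>I\<close> and -1 towards the other neighbours. It is maximal at \<open>v\<close>, and the
  face where the maximum is attained contains exactly the neighbours in \<open>I\<close>.\<close>

lemma simple_polytope_face_exists:
  assumes "simple_polytope d P" "v \<in> verts P" "I \<subseteq> nbrs (poly_graph P) v"
  obtains F where "F face_of P" "v \<in> F" "nbrs (poly_graph P) v \<inter> F = I"
proof -
  let ?N = "nbrs (poly_graph P) v"
  have P: "polytope P"
    using assms(1) by (auto simp: simple_polytope_def)
  obtain g :: "'a \<Rightarrow> real" where g: "linear g"
      "\<forall>y\<in>(\<lambda>u. u - v) ` ?N. g y = (if y + v \<in> I then 0 else - 1)"
    using linear_independent_extend[OF simple_polytope_independent[OF assms(1,2)],
        of "\<lambda>y. if y + v \<in> I then 0 else - 1 :: real"] by blast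
  \<comment> \<open>The vector that represents \<open>g\<close> as an inner product.\<close>
  define a where "a = adjoint g 1"
  have a: "a \<bullet> y = g y" for y
    using adjoint_works[OF g(1), of y 1] by (simp add: a_def inner_commute)
  have aN: "a \<bullet> u = a \<bullet> v + (if u \<in> I then 0 else - 1)" if "u \<in> ?N" for u
    using g(2) that by (auto simp: inner_diff_right simp flip: a)
  have le: "a \<bullet> x \<le> a \<bullet> v" if "x \<in> P" for x
    using aN by (intro linear_functional_vertex_bound[OF P assms(2) that]) (auto split: if_splits)
  have "?N \<subseteq> P"
    by (auto simp: nbrs_poly_graph edge_of_def dest!: face_of_imp_subset)
  then have "?N \<inter> (P \<inter> {x. a \<bullet> x = a \<bullet> v}) = I"
    using aN assms(3) by (auto split: if_splits)
  moreover have "(P \<inter> {x. a \<bullet> x = a \<bullet> v}) face_of P"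
    using le polytope_imp_convex[OF P] by (intro face_of_Int_supporting_hyperplane_le) auto
  moreover have "v \<in> P \<inter> {x. a \<bullet> x = a \<bullet> v}"
    using assms(2) verts_subset by auto
  ultimately show thesis
    using that by blast
qed

text \<open>Dimension is counted by neighbours. Two such faces meet in a face with at least
  \<open>k\<close> neighbours of \<open>v\<close>, hence of dimension at least \<open>k\<close>, and
  this must be all of either one.\<close>

lemma simple_polytope_ex1_k_face:
  assumes "simple_polytope d P" "v \<in> verts P" "I \<subseteq> nbrs (poly_graph P) v" "card I = k"
  shows "\<exists>!F. F \<in> k_faces k P \<and> insert v I \<subseteq> F"
proof (rule ex_ex1I)
  obtain F where F: "F face_of P" "v \<in> F" "nbrs (poly_graph P) v \<inter> F = I"
    using simple_polytope_face_exists[OF assms(1-3)] .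
  then have "aff_dim F = int k"
    using simple_polytope_aff_dim_face[OF assms(1,2)] assms(4) by simp
  then show "\<exists>F. F \<in> k_faces k P \<and> insert v I \<subseteq> F"
    using F by (intro exI[of _ F]) (auto simp: k_faces_def)
next
  fix F H
  assume "F \<in> k_faces k P \<and> insert v I \<subseteq> F" "H \<in> k_faces k P \<and> insert v I \<subseteq> H"
  then have F: "F face_of P" "aff_dim F = int k" "insert v I \<subseteq> F"
    and H: "H face_of P" "aff_dim H = int k" "insert v I \<subseteq> H"
    by (auto simp: k_faces_def)
  have P: "polytope P"
    using assms(1) by (auto simp: simple_polytope_def)
  have FH: "F \<inter> H face_of P"
    using F(1) H(1) by (rule face_of_Int)
  have "I \<subseteq> nbrs (poly_graph P) v \<inter> (F \<inter> H)"
    using F(3) H(3) assms(3) by blast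
  then have "k \<le> card (nbrs (poly_graph P) v \<inter> (F \<inter> H))"
    unfolding assms(4)[symmetric] using finite_nbrs_poly_graph[OF P] by (intro card_mono) auto
  then have "int k \<le> aff_dim (F \<inter> H)"
    using simple_polytope_aff_dim_face[OF assms(1,2) FH] F(3) H(3) by simp
  moreover have "F \<inter> H = K" if K: "K face_of P" "aff_dim K = int k" "F \<inter> H \<subseteq> K" 
      "int k \<le> aff_dim (F \<inter> H)" for K
  proof -
    have "F \<inter> H face_of K"
      using FH K by (simp add: face_of_face)
    then show ?thesis
      using face_of_aff_dim_lt[of K "F \<inter> H"] K face_of_imp_convex[OF K(1)] by force
  qed
  ultimately show "F = H"
    using F H by (metis inf_le1 inf_le2)
qed

subsection \<open>Generic linear functionals\<close>

text \<open>\<open>a\<close> is perturbed by a small positive multiple of \<open>c\<close>. For each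
  vector the sign is right for all small enough multiples, and finiteness of \<open>D\<close> gives
  a common one.\<close>

lemma lexicographic_functional:
  fixes a c :: "'a::euclidean_space"
  assumes "finite D"
  obtains b where "\<And>x. x \<in> D \<Longrightarrow> sgn (b \<bullet> x) = (if a \<bullet> x \<noteq> 0 then sgn (a \<bullet> x) else sgn (c \<bullet> x))"
proof -
  have "\<forall>\<^sub>F e in at_right 0. sgn ((a + e *\<^sub>R c) \<bullet> x) = (if a \<bullet> x \<noteq> 0 then sgn (a \<bullet> x) else sgn (c \<bullet> x))"
    for x
  proof -
    have *: "((\<lambda>e. (a + e *\<^sub>R c) \<bullet> x) \<longlongrightarrow> a \<bullet> x) (at_right 0)"
      by (auto intro!: tendsto_eq_intros)
    consider "a \<bullet> x < 0" | "a \<bullet> x > 0" | "a \<bullet> x = 0" by linarith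
    then show ?thesis
    proof cases
      case 1
      then show ?thesis
        using order_tendstoD(2)[OF * 1] by (auto elim: eventually_mono)
    next
      case 2
      then show ?thesis
        using order_tendstoD(1)[OF * 2] by (auto elim: eventually_mono)
    next
      case 3
      show ?thesis
        by (rule eventually_mono[OF eventually_at_right_less]) (simp add: 3 inner_add_left sgn_mult)
    qed
  qed
  then have "\<forall>\<^sub>F e in at_right (0::real). \<forall>x\<in>D. sgn ((a + e *\<^sub>R c) \<bullet> x)
      = (if a \<bullet> x \<noteq> 0 then sgn (a \<bullet> x) else sgn (c \<bullet> x))"
    using assms by (intro eventually_ball_finite) blast+
  then show thesis
    using that eventually_happens'[OF trivial_limit_at_right_real] by blast
qed

lemma nonvanishing_functional:
  fixes D :: "'a::euclidean_space set"
  assumes "finite D" "0 \<notin> D"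
  shows "\<exists>b. \<forall>x\<in>D. b \<bullet> x \<noteq> 0"
  using assms
proof (induction rule: finite_induct)
  case (insert y D)
  then obtain a where a: "\<And>x. x \<in> D \<Longrightarrow> a \<bullet> x \<noteq> 0"
    by auto
  \<comment> \<open>Perturbing by \<open>y\<close> itself helps where it is needed: if
    \<open>a\<close> vanishes at \<open>y\<close>, the sign of \<open>y\<close> under
    \<open>b\<close> is that of its squared norm.\<close>
  obtain b where b: "\<And>x. x \<in> insert y D \<Longrightarrow>
      sgn (b \<bullet> x) = (if a \<bullet> x \<noteq> 0 then sgn (a \<bullet> x) else sgn (y \<bullet> x))"
    using lexicographic_functional[of "insert y D" a y] insert.hyps(1) by auto
  have "b \<bullet> x \<noteq> 0" if "x \<in> insert y D" for x
  proof
    assume "b \<bullet> x = 0"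
    then have "a \<bullet> x = 0 \<and> y \<bullet> x = 0"
      using b[OF that] by (auto simp: sgn_0_0 split: if_splits)
    then show False
      using that a insert.prems by auto
  qed
  then show ?case by blast
qed simp

text \<open>The signs of \<open>b\<close> on differences encode its order on \<open>V\<close>. Two
  lexicographic perturbations rank by \<open>a\<close>, then by \<open>c\<close>, then by a
  functional without zeros on the differences, which breaks all remaining ties.\<close>

lemma generic_functional:
  fixes V :: "'a::euclidean_space set"
  assumes "finite V"
  obtains b where "inj_on (\<lambda>x. b \<bullet> x) V"
    and "\<And>x y. x \<in> V \<Longrightarrow> y \<in> V \<Longrightarrow> a \<bullet> x < a \<bullet> y \<Longrightarrow> b \<bullet> x < b \<bullet> y"
    and "\<And>x y. x \<in> V \<Longrightarrow> y \<in> V \<Longrightarrow> a \<bullet> x = a \<bullet> y \<Longrightarrow> c \<bullet> x < c \<bullet> y \<Longrightarrow> b \<bullet> x < b \<bullet> y"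
proof -
  let ?D = "(\<lambda>(x, y). y - x) ` {(x, y) \<in> V \<times> V. x \<noteq> y}"
  have fin: "finite ?D"
    using assms by (intro finite_imageI) (auto intro: finite_subset[of _ "V \<times> V"])
  have D: "y - x \<in> ?D" if "x \<in> V" "y \<in> V" "x \<noteq> y" for x y
    using that by (auto simp: image_iff)
  have "0 \<notin> ?D"
    by auto
  then obtain u where u: "\<And>z. z \<in> ?D \<Longrightarrow> u \<bullet> z \<noteq> 0"
    using nonvanishing_functional[OF fin] by blast
  obtain c' where c': "\<And>z. z \<in> ?D \<Longrightarrow> sgn (c' \<bullet> z) = (if c \<bullet> z \<noteq> 0 then sgn (c \<bullet> z) else sgn (u \<bullet> z))"
    using lexicographic_functional[OF fin] by blast
  obtain b where b: "\<And>z. z \<in> ?D \<Longrightarrow> sgn (b \<bullet> z) = (if a \<bullet> z \<noteq> 0 then sgn (a \<bullet> z) else sgn (c' \<bullet> z))"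
    using lexicographic_functional[OF fin] by blast
  have pos: "b \<bullet> x < b \<bullet> y" if "y - x \<in> ?D" "sgn (b \<bullet> (y - x)) = 1" for x y
    using that(2) by (simp add: sgn_1_pos inner_diff_right)
  show thesis
  proof (rule that[of b])
    show "inj_on (\<lambda>x. b \<bullet> x) V"
    proof (rule inj_onI, rule ccontr)
      fix x y assume xy: "x \<in> V" "y \<in> V" "b \<bullet> x = b \<bullet> y" "x \<noteq> y"
      then have z: "y - x \<in> ?D" "b \<bullet> (y - x) = 0"
        using D by (auto simp: inner_diff_right)
      then show False
        using b[OF z(1)] c'[OF z(1)] u[OF z(1)] by (simp add: sgn_0_0 split: if_splits)
    qed
    show "b \<bullet> x < b \<bullet> y" if "x \<in> V" "y \<in> V" "a \<bullet> x < a \<bullet> y" for x y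
    proof -
      have z: "y - x \<in> ?D"
        using that by (intro D) auto
      show ?thesis
        using that b[OF z] by (intro pos[OF z]) (simp add: inner_diff_right)
    qed
    show "b \<bullet> x < b \<bullet> y" if "x \<in> V" "y \<in> V" "a \<bullet> x = a \<bullet> y" "c \<bullet> x < c \<bullet> y" for x y
    proof -
      have z: "y - x \<in> ?D"
        using that by (intro D) auto
      show ?thesis
        using that b[OF z] c'[OF z] by (intro pos[OF z]) (simp add: inner_diff_right)
    qed
  qed
qed

text \<open>Take the lexicographic order of minus a functional exposing \<open>F\<close>, then one exposing \<open>v\<close>, then a
  generic one.\<close>

lemma face_separating_functional:
  assumes P: "polytope P" and F: "F face_of P" and v: "v \<in> verts F"
  obtains b where "inj_on (\<lambda>x. b \<bullet> x) (verts P)"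
    and "\<And>x. x \<in> verts P \<Longrightarrow> b \<bullet> x \<le> b \<bullet> v \<Longrightarrow> x \<in> F"
    and "\<And>x. x \<in> verts F \<Longrightarrow> b \<bullet> x \<le> b \<bullet> v"
proof -
  have poly: "polyhedron P"
    using P by (rule polytope_imp_polyhedron)
  obtain a r where a: "P \<subseteq> {x. a \<bullet> x \<le> r}" "F = P \<inter> {x. a \<bullet> x = r}"
    using F exposed_face_of_polyhedron[OF poly] unfolding exposed_face_of_def by blast
  have "{v} face_of P"
    using v verts_face[OF F] by (auto simp: verts_def face_of_singleton)
  then obtain c s where c: "P \<subseteq> {x. c \<bullet> x \<le> s}" "{v} = P \<inter> {x. c \<bullet> x = s}"
    using exposed_face_of_polyhedron[OF poly] unfolding exposed_face_of_def by blast
  have vF: "v \<in> verts P" "a \<bullet> v = r" "c \<bullet> v = s"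
    using v a(2) c(2) verts_face[OF F] by auto
  \<comment> \<open>\<open>a\<close> is largest on \<open>F\<close>, so ranking by
    \<open>- a\<close> first puts \<open>F\<close> lowest; \<open>c\<close> is largest at
    \<open>v\<close>, so it puts \<open>v\<close> on top within \<open>F\<close>.\<close>
  obtain b where inj: "inj_on (\<lambda>x. b \<bullet> x) (verts P)"
    and 1: "\<And>x y. x \<in> verts P \<Longrightarrow> y \<in> verts P \<Longrightarrow> - a \<bullet> x < - a \<bullet> y \<Longrightarrow> b \<bullet> x < b \<bullet> y"
    and 2: "\<And>x y. x \<in> verts P \<Longrightarrow> y \<in> verts P \<Longrightarrow> - a \<bullet> x = - a \<bullet> y \<Longrightarrow> c \<bullet> x < c \<bullet> y
      \<Longrightarrow> b \<bullet> x < b \<bullet> y"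
    using generic_functional[OF finite_verts[OF P], of "- a" c] by blast
  show thesis
  proof (rule that[OF inj])
    fix x assume x: "x \<in> verts P" "b \<bullet> x \<le> b \<bullet> v"
    then have xP: "x \<in> P"
      using verts_subset by blast
    have "\<not> a \<bullet> x < r"
      using 1[of v x] x vF by auto
    then show "x \<in> F"
      using xP a by force
  next
    fix x assume "x \<in> verts F"
    then have x: "x \<in> verts P" "x \<in> P" "a \<bullet> x = r"
      using verts_face[OF F] a(2) by auto
    show "b \<bullet> x \<le> b \<bullet> v"
    proof (cases "x = v")
      case False
      then have "c \<bullet> x < s"
        using c x(2) by force
      then show ?thesis
        using 2[of x v] x vF by simp
    qed simp
  qed
qed

section \<open>Orientations induced by linear functionals\<close>

definition functional_orientation :: "'a::euclidean_space set \<Rightarrow> 'a \<Rightarrow> ('a \<times> 'a) set" where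
  "functional_orientation P b = {(u, v). {u, v} \<in> edges (poly_graph P) \<and> b \<bullet> u < b \<bullet> v}"

lemma acyclic_functional_orientation:
  assumes "polytope P" "inj_on (\<lambda>x. b \<bullet> x) (verts P)"
  shows "acyclic_orientation (poly_graph P) (functional_orientation P b)"
  using acyclic_orientation_of_injection[OF simple_graph_poly_graph[OF assms(1)], of "\<lambda>x. b \<bullet> x"]
    assms(2) by (simp add: functional_orientation_def poly_graph_def)

text \<open>A sink is a local maximum of \<open>b\<close> in the graph of \<open>F\<close>, and
  \<open>linear_functional_vertex_bound\<close> is applied to the polytope \<open>F\<close>
  itself.\<close>

lemma functional_sink_maximal:
  assumes P: "polytope P" and F: "F face_of P"
    and sink: "is_sink (functional_orientation P b) (induced (poly_graph P) (verts F)) v"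
    and x: "x \<in> F"
  shows "b \<bullet> x \<le> b \<bullet> v"
proof -
  have v: "v \<in> verts F"
    using sink by (simp add: is_sink_induced)
  then have vF: "v \<in> F"
    using verts_subset by blast
  have PF: "polytope F"
    using P F face_of_polytope_polytope by blast
  have "b \<bullet> u \<le> b \<bullet> v" if "u \<in> nbrs (poly_graph F) v" for u
  proof -
    have "u \<in> nbrs (poly_graph P) v \<inter> verts F"
      using that nbrs_face[OF F vF] nbrs_poly_graph_subset[OF PF] by blast
    then show ?thesis
      using sink by (auto simp: is_sink_induced functional_orientation_def)
  qed
  then show ?thesis
    using linear_functional_vertex_bound[OF PF v x] by blast
qed

text \<open>All sinks attain the maximum of \<open>b\<close> on \<open>F\<close>, and
  \<open>b\<close> separates vertices.\<close>

lemma functional_unique_sink: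
  assumes P: "polytope P" and inj: "inj_on (\<lambda>x. b \<bullet> x) (verts P)" and F: "F face_of P" "F \<noteq> {}"
  shows "\<exists>!v. is_sink (functional_orientation P b) (induced (poly_graph P) (verts F)) v"
proof (rule ex_ex1I)
  have "polytope F"
    using P F(1) face_of_polytope_polytope by blast
  then have "finite (verts F)" "verts F \<noteq> {}"
    using finite_verts polytope_eq_hull_verts F(2) by force+
  then show "\<exists>v. is_sink (functional_orientation P b) (induced (poly_graph P) (verts F)) v"
    using sink_exists acyclic_functional_orientation[OF P inj] by blast
next
  fix v w
  assume v: "is_sink (functional_orientation P b) (induced (poly_graph P) (verts F)) v"
    and w: "is_sink (functional_orientation P b) (induced (poly_graph P) (verts F)) w"
  then have vw: "v \<in> verts F" "w \<in> verts F"
    by (auto simp: is_sink_induced)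
  then have "b \<bullet> v \<le> b \<bullet> w" "b \<bullet> w \<le> b \<bullet> v"
    using functional_sink_maximal[OF P F(1)] v w verts_subset by blast+
  moreover have "v \<in> verts P" "w \<in> verts P"
    using vw verts_face[OF F(1)] by auto
  ultimately show "v = w"
    using inj by (auto dest: inj_onD)
qed

subsection \<open>Frame systems of simple polytopes\<close>

lemma frame_system_faces:
  assumes simple: "simple_polytope d P"
  shows "frame_system k (poly_graph P) (face_vertex_sets k P)"
proof -
  let ?G = "poly_graph P"
  have P: "polytope P"
    using simple by (simp add: simple_polytope_def)
  have nodes: "nodes ?G = verts P"
    by (simp add: poly_graph_def)
  have nb: "nbrs ?G v \<subseteq> verts P" for v
    using nbrs_poly_graph_subset[OF P] .
  have sub: "verts F = verts P \<inter> F" if "F \<in> k_faces k P" for F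
    using that verts_face by (auto simp: k_faces_def)
  have sets: "S \<noteq> {} \<and> S \<subseteq> nodes ?G \<and> (\<forall>v\<in>S. card (nbrs ?G v \<inter> S) = k)" if S: "S \<in> face_vertex_sets k P" for S
  proof -
    obtain F where F: "F \<in> k_faces k P" "S = verts F"
      using S by (auto simp: face_vertex_sets_def)
    then have face: "F face_of P" and dim: "aff_dim F = int k"
      by (auto simp: k_faces_def)
    have "F \<noteq> {}"
      using dim by auto
    then have "S \<noteq> {}"
      using polytope_eq_hull_verts[OF face_of_polytope_polytope[OF P face]] F(2) by auto
    moreover have "card (nbrs ?G v \<inter> S) = k" if "v \<in> S" for v
    proof -
      have "nbrs ?G v \<inter> S = nbrs ?G v \<inter> F"
        using nb sub[OF F(1)] F(2) by blast
      then show ?thesis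
        using simple_polytope_aff_dim_face[OF simple _ face, of v] dim that sub[OF F(1)] F(2) by simp
    qed
    ultimately show ?thesis
      using F sub nodes by auto
  qed
  have frames: "\<exists>!S. S \<in> face_vertex_sets k P \<and> insert v I \<subseteq> S"
    if v: "v \<in> verts P" and I: "I \<subseteq> nbrs ?G v" "card I = k" for v I
  proof -
    have ex1: "\<exists>!F. F \<in> k_faces k P \<and> insert v I \<subseteq> F"
      using simple_polytope_ex1_k_face[OF simple v I] .
    \<comment> \<open>The frame consists of vertices of \<open>P\<close>, so faces may be replaced
      by their vertex sets.\<close>
    have iff: "insert v I \<subseteq> verts F \<longleftrightarrow> insert v I \<subseteq> F" if "F \<in> k_faces k P" for F
      using sub[OF that] v I(1) nb by blast
    show ?thesis
      unfolding face_vertex_sets_def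
    proof (rule ex_ex1I)
      show "\<exists>S. S \<in> verts ` k_faces k P \<and> insert v I \<subseteq> S"
        using ex1 iff by blast
      show "S = T" if "S \<in> verts ` k_faces k P \<and> insert v I \<subseteq> S"
          "T \<in> verts ` k_faces k P \<and> insert v I \<subseteq> T" for S T
        using that ex1 iff by (metis (no_types, lifting) imageE)
    qed
  qed
  show ?thesis
    by (rule frame_systemI; (rule sets | rule frames[folded nodes]); assumption)
qed

lemma k_frame_of_nbrs:
  assumes P: "polytope P" and v: "v \<in> verts P"
    and I: "I \<subseteq> nbrs (poly_graph P) v" "card I = k" "0 < k"
  shows "k_frame k P \<lparr>nodes = insert v I, edges = {{v, u} | u. u \<in> I}\<rparr>"
proof -
  let ?H = "\<lparr>nodes = insert v I, edges = {{v, u} | u. u \<in> I}\<rparr>"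
  \<comment> \<open>An infinite set has \<open>card\<close> equal to 0, which is excluded by
    \<open>0 < k\<close>.\<close>
  have finI: "finite I"
    using I card.infinite by force
  have vI: "v \<notin> I"
    using I(1) simple_graph_nbrs(2)[OF simple_graph_poly_graph[OF P]] by blast
  have "is_subgraph ?H (poly_graph P)"
    unfolding is_subgraph_def
  proof (intro conjI)
    show "simple_graph ?H"
      using finI vI by (auto simp: simple_graph_def card_2_iff)
    show "nodes ?H \<subseteq> nodes (poly_graph P)"
      using v I(1) nbrs_poly_graph_subset[OF P] by (auto simp: poly_graph_def)
    show "edges ?H \<subseteq> edges (poly_graph P)"
      using I(1) by (auto simp: nbrs_def insert_commute)
  qed
  moreover have "graph_isomorphic ?H (star k)"
  proof -
    have "card I = card {1..k}"
      using I(2) by simp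
    then obtain g where g: "bij_betw g I {1..k}"
      using finI finite_same_card_bij[of I "{1..k}"] by blast
    define f where "f x = (if x = v then 0 else g x)" for x
    have fv: "f v = 0" and fI: "\<And>x. x \<in> I \<Longrightarrow> f x = g x"
      using vI by (auto simp: f_def)
    have gI: "g x \<in> {1..k}" if "x \<in> I" for x
      using g that bij_betwE by blast
    have "bij_betw f I {1..k}"
      using g fI by (subst bij_betw_cong[of I f g]) auto
    then have "bij_betw f (insert v I) (insert (f v) {1..k})"
      using fv bij_betw_combine[of f "{v}" "{f v}" I "{1..k}"] by simp
    moreover have "insert (f v) {1..k} = {0..k}"
      using fv by auto
    ultimately have bij: "bij_betw f (insert v I) {0..k}"
      by simp
    have "{x, y} \<in> edges ?H \<longleftrightarrow> {f x, f y} \<in> edges (star k)" if "x \<in> insert v I" "y \<in> insert v I" for x y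
    proof -
      have "{x, y} \<in> edges ?H \<longleftrightarrow> x = v \<and> y \<in> I \<or> y = v \<and> x \<in> I"
        by (auto simp: doubleton_eq_iff)
      also have "\<dots> \<longleftrightarrow> f x = 0 \<and> f y \<in> {1..k} \<or> f y = 0 \<and> f x \<in> {1..k}"
        using that fv fI gI vI by (metis atLeastAtMost_iff insert_iff not_one_le_zero)
      also have "\<dots> \<longleftrightarrow> {f x, f y} \<in> edges (star k)"
        by (auto simp: star_def doubleton_eq_iff)
      finally show ?thesis .
    qed
    then show ?thesis
      unfolding graph_isomorphic_def using bij by (intro exI[of _ f]) (simp add: star_def)
  qed
  ultimately show ?thesis
    by (simp add: k_frame_def)
qed

lemma frame_system_of_k_system:
  assumes P: "polytope P" and k: "0 < k" and sys: "k_system k P \<S>"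
  shows "frame_system k (poly_graph P) \<S>"
proof -
  let ?G = "poly_graph P"
  have nodes: "nodes ?G = verts P"
    by (simp add: poly_graph_def)
  have sets: "S \<noteq> {} \<and> S \<subseteq> nodes ?G \<and> (\<forall>v\<in>S. card (nbrs ?G v \<inter> S) = k)" if "S \<in> \<S>" for S
    using that sys regular_induced_iff[OF simple_graph_poly_graph[OF P]] nodes
    unfolding k_system_def by metis
  have frames: "\<exists>!S. S \<in> \<S> \<and> insert v I \<subseteq> S"
    if "v \<in> verts P" "I \<subseteq> nbrs ?G v" "card I = k" for v I
  proof -
    have "\<forall>H. k_frame k P H \<longrightarrow> (\<exists>!S. S \<in> \<S> \<and> nodes H \<subseteq> S)"
      using sys by (simp add: k_system_def)
    from this[rule_format, OF k_frame_of_nbrs[OF P that k]] show ?thesis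
      by simp
  qed
  show ?thesis
    by (rule frame_systemI; (rule sets | rule frames[folded nodes]); assumption)
qed

section \<open>The equality case of the first inequality\<close>

lemma finite_attains_max:
  fixes f :: "'b \<Rightarrow> 'c::linorder"
  assumes "finite S" "S \<noteq> {}"
  shows "\<exists>w\<in>S. \<forall>x\<in>S. f x \<le> f w"
proof -
  have "Max (f ` S) \<in> f ` S"
    using assms by (intro Max_in) auto
  then obtain w where "w \<in> S" "Max (f ` S) = f w"
    by auto
  then show ?thesis
    using assms(1) Max_ge[of "f ` S"] by (intro bexI[of _ w]) auto
qed

lemma unique_sinks_imp_face:
  assumes simple: "simple_polytope d P" and sys: "frame_system k (poly_graph P) \<S>" and S: "S \<in> \<S>"
    and uniq: "\<And>b. inj_on (\<lambda>x. b \<bullet> x) (verts P) \<Longrightarrow>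
      \<exists>!v. is_sink (functional_orientation P b) (induced (poly_graph P) S) v"
  shows "S \<in> face_vertex_sets k P"
proof -
  let ?G = "poly_graph P"
  have P: "polytope P"
    using simple by (simp add: simple_polytope_def)
  have G: "simple_graph ?G"
    using P by (rule simple_graph_poly_graph)
  have SP: "S \<noteq> {}" "S \<subseteq> verts P"
    using sys S by (auto simp: frame_system_def poly_graph_def)
  have finS: "finite S"
    using SP(2) finite_verts[OF P] finite_subset by blast
  obtain v where v: "v \<in> S"
    using SP(1) by blast
  have vP: "v \<in> verts P"
    using v SP(2) by blast
  obtain F where F: "F \<in> k_faces k P" "insert v (nbrs ?G v \<inter> S) \<subseteq> F"
    using simple_polytope_ex1_k_face[OF simple vP _ frame_system_card[OF sys S v]] by blast
  have face: "F face_of P"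
    using F(1) by (simp add: k_faces_def)
  have vertsF: "verts F = verts P \<inter> F"
    using face by (rule verts_face)
  have sysF: "frame_system k ?G (face_vertex_sets k P)" and FF: "verts F \<in> face_vertex_sets k P"
    using frame_system_faces[OF simple] F(1) by (auto simp: face_vertex_sets_def)
  have vF: "v \<in> verts F"
    using vertsF vP F(2) by blast
  obtain b where inj: "inj_on (\<lambda>x. b \<bullet> x) (verts P)"
    and low: "\<And>x. x \<in> verts P \<Longrightarrow> b \<bullet> x \<le> b \<bullet> v \<Longrightarrow> x \<in> F"
    and top: "\<And>x. x \<in> verts F \<Longrightarrow> b \<bullet> x \<le> b \<bullet> v"
    using face_separating_functional[OF P face vF] by blast
  let ?A = "functional_orientation P b"
  have sinkI: "is_sink ?A (induced ?G T) w"
    if w: "w \<in> T" "w \<in> verts P" "\<And>u. u \<in> nbrs ?G w \<inter> T \<Longrightarrow> b \<bullet> u \<le> b \<bullet> w" for T w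
  proof -
    have "(u, w) \<in> ?A" if u: "u \<in> nbrs ?G w \<inter> T" for u
    proof -
      have "u \<in> verts P" "u \<noteq> w"
        using u nbrs_poly_graph_subset[OF P] simple_graph_nbrs(2)[OF G] by auto
      then have "b \<bullet> u \<noteq> b \<bullet> w"
        using inj w(2) by (auto dest: inj_onD)
      then show ?thesis
        using w(3)[OF u] u by (simp add: functional_orientation_def nbrs_def)
    qed
    then show ?thesis
      using w(1) by (auto simp: is_sink_induced)
  qed
  \<comment> \<open>The neighbours of \<open>v\<close> in \<open>S\<close> lie in \<open>F\<close>,
    where \<open>v\<close> is highest.\<close>
  have sink_v: "is_sink ?A (induced ?G S) v"
    using v vP F(2) SP(2) top vertsF by (intro sinkI) blast+
  obtain w where w: "w \<in> S" "\<And>x. x \<in> S \<Longrightarrow> b \<bullet> x \<le> b \<bullet> w"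
    using finite_attains_max[OF finS SP(1), of "\<lambda>x. b \<bullet> x"] by blast
  \<comment> \<open>The highest node of \<open>S\<close> is a sink too, so by uniqueness it is
    \<open>v\<close>; then all of \<open>S\<close> is at most as high as \<open>v\<close> and lies
    in \<open>F\<close>.\<close>
  have "is_sink ?A (induced ?G S) w"
    using w SP(2) by (intro sinkI) auto
  then have "w = v"
    using uniq[OF inj] sink_v by blast
  then have SF: "S \<subseteq> verts F"
    using w(2) low SP(2) vertsF by blast
  have "verts F - S = {}"
  proof (rule ccontr)
    assume ne: "verts F - S \<noteq> {}"
    have fin: "finite (verts F - S)"
      using finite_verts[OF P] vertsF by simp
    then obtain m where m: "m \<in> verts F - S" "\<And>x. x \<in> verts F - S \<Longrightarrow> b \<bullet> x \<le> b \<bullet> m"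
      using finite_attains_max[OF fin ne, of "\<lambda>x. b \<bullet> x"] by blast
    \<comment> \<open>A node of \<open>S\<close> has \<open>k\<close> neighbours in \<open>S\<close>
      and \<open>k\<close> in \<open>F\<close>. With \<open>S\<close> inside \<open>F\<close> these
      agree, so no edge joins \<open>S\<close> to the rest of \<open>F\<close>.\<close>
    have "u \<notin> S" if "u \<in> nbrs ?G m" for u
    proof
      assume u: "u \<in> S"
      then have "card (nbrs ?G u \<inter> S) = card (nbrs ?G u \<inter> verts F)"
        using frame_system_card[OF sys S] frame_system_card[OF sysF FF] SF by auto
      then have "nbrs ?G u \<inter> S = nbrs ?G u \<inter> verts F"
        using SF simple_graph_nbrs(3)[OF G] by (intro card_subset_eq) auto
      then show False
        using m(1) that u nbrs_sym[of m ?G u] by blast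
    qed
    \<comment> \<open>The neighbours of \<open>m\<close> in \<open>F\<close> all avoid
      \<open>S\<close>, so \<open>m\<close> is a sink of the whole face and must be as high as
      \<open>v\<close>.\<close>
    then have "is_sink ?A (induced ?G (verts F)) m"
      using m vertsF by (intro sinkI) auto
    then have "b \<bullet> v \<le> b \<bullet> m"
      using functional_sink_maximal[OF P face] vF verts_subset by blast
    then have "b \<bullet> v = b \<bullet> m"
      using top m(1) by (simp add: order_antisym)
    then show False
      using inj vP m(1) v vertsF by (auto dest: inj_onD)
  qed
  then have "S = verts F"
    using SF by blast
  then show ?thesis
    using FF by simp
qed

theorem theorem1:
  fixes P :: "'a::euclidean_space set" and d k :: nat
    and \<S> :: "'a set set" and A :: "('a \<times> 'a) set"
  assumes "simple_polytope d P"
    and "2 \<le> k" and "k \<le> d - 1"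
    and "k_system k P \<S>"
    and "acyclic_orientation (poly_graph P) A"
  shows "card \<S> \<le> f_num k P \<and> f_num k P \<le> H_num (poly_graph P) d A k \<and>
    (card \<S> = f_num k P \<longleftrightarrow> \<S> = face_vertex_sets k P) \<and>
    (f_num k P = H_num (poly_graph P) d A k \<longleftrightarrow>
       (\<forall>F\<in>k_faces k P. \<exists>!v. is_sink A (induced (poly_graph P) (verts F)) v))"
proof -
  let ?G = "poly_graph P" and ?\<F> = "face_vertex_sets k P"
  have P: "polytope P"
    using assms(1) by (simp add: simple_polytope_def)
  have G: "simple_graph ?G"
    using P by (rule simple_graph_poly_graph)
  have deg: "card (nbrs ?G v) \<le> d" if "v \<in> nodes ?G" for v
    using simple_polytope_card_nbrs[OF assms(1), of v] that by (simp add: poly_graph_def)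
  have sys: "frame_system k ?G \<S>"
    using frame_system_of_k_system[OF P _ assms(4)] assms(2) by simp
  have sysF: "frame_system k ?G ?\<F>"
    using frame_system_faces[OF assms(1)] .
  have f: "f_num k P = card ?\<F>"
    using f_num_eq[OF P] .
  have acyc: "acyclic_orientation ?G (functional_orientation P b)"
    if "inj_on (\<lambda>x. b \<bullet> x) (verts P)" for b
    using acyclic_functional_orientation[OF P that] .
  \<comment> \<open>For a generic functional the second inequality is an equality, whatever the
    choice of \<open>b\<close>.\<close>
  have fH: "card ?\<F> = H_num ?G d (functional_orientation P b) k"
    if inj: "inj_on (\<lambda>x. b \<bullet> x) (verts P)" for b
  proof (subst frame_system_card_le_H_num(2)[OF G acyc[OF inj] sysF deg])
    show "\<forall>S\<in>?\<F>. \<exists>!v. is_sink (functional_orientation P b) (induced ?G S) v"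
    proof
      fix S assume "S \<in> ?\<F>"
      then obtain F where F: "F face_of P" "aff_dim F = int k" "S = verts F"
        by (auto simp: face_vertex_sets_def k_faces_def)
      then have "F \<noteq> {}"
        by auto
      then show "\<exists>!v. is_sink (functional_orientation P b) (induced ?G S) v"
        using functional_unique_sink[OF P inj F(1)] F(3) by simp
    qed
  qed
  \<comment> \<open>Only injectivity is wanted here, so both ranking functionals are 0.\<close>
  obtain b where inj: "inj_on (\<lambda>x. b \<bullet> x) (verts P)"
    by (rule generic_functional[OF finite_verts[OF P], of 0 0]) (rule that)
  have le: "card \<S> \<le> card ?\<F>"
    using frame_system_card_le_H_num(1)[OF G acyc[OF inj] sys deg] fH[OF inj] by simp
  have "\<S> = ?\<F>" if eq: "card \<S> = card ?\<F>"
  proof (rule card_subset_eq)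
    show "finite ?\<F>"
      unfolding face_vertex_sets_def k_faces_def
      using finite_polytope_faces[OF P] by (auto intro: finite_subset[rotated])
    show "\<S> \<subseteq> ?\<F>"
    proof
      fix S assume S: "S \<in> \<S>"
      \<comment> \<open>By \<open>fH\<close> and \<open>eq\<close>, the size of the system equals
        \<open>H_num\<close> for every generic \<open>b\<close>, so none of its members has a second
        sink.\<close>
      have "\<exists>!v. is_sink (functional_orientation P b) (induced ?G S) v"
        if inj: "inj_on (\<lambda>x. b \<bullet> x) (verts P)" for b
        using frame_system_card_le_H_num(2)[OF G acyc[OF inj] sys deg] fH[OF inj] eq S by simp
      then show "S \<in> ?\<F>"
        using unique_sinks_imp_face[OF assms(1) sys S] by blast
    qed
  qed (rule eq)
  then have "card \<S> = card ?\<F> \<longleftrightarrow> \<S> = ?\<F>"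
    by auto
  moreover have "(\<forall>F\<in>k_faces k P. \<exists>!v. is_sink A (induced ?G (verts F)) v)
      \<longleftrightarrow> (\<forall>S\<in>?\<F>. \<exists>!v. is_sink A (induced ?G S) v)"
    by (simp add: face_vertex_sets_def)
  ultimately show ?thesis
    using le frame_system_card_le_H_num[OF G assms(5) sysF deg] f by simp
qed

end
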